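(* Let $\mathbb{F}$ be a field, $d\in\mathbb{N}=\{0,1,2,\dots\}$, and $V$ a $(d+1)$-dimensional $\mathbb{F}$-vector space. Let $\Phi=(A;\{E_i\}_{i=0}^d;A^*;\{E_i^*\}_{i=0}^d)$ be a Leonard system on $V$, and for $0\le i\le d$ let $\theta_i$ be the eigenvalue of $A$ corresponding to $E_i$. Fix a nonzero $\mathbf{v}\in E_0^*V$, and for $(r,s,t)\in\Delta_d$ let $\mathcal{L}_{(r,s,t)}=\eta_r(A)\tau_t(A)\mathbf{v}$. Let $\{U_i^{\Downarrow}\}_{i=0}^d$ denote the $\Phi^{\Downarrow}$-split decomposition of $V$. For $0\le i\le d$ consider the location $\lambda_i=(0,d-i,i)\in\Delta_d$. Then $\mathcal{L}_{\lambda_i}\in U_i^{\Downarrow}$.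
   Context: A linear map $V\to V$ is multiplicity-free if it is diagonalizable and every eigenspace has dimension 1. The primitive idempotent of such a map corresponding to an eigenvalue $\theta$ is the linear map acting as the identity on the $\theta$-eigenspace and as $0$ on the other eigenspaces. A Leonard system on $V$ is a sequence $\Phi=(A;\{E_i\}_{i=0}^d;A^*;\{E_i^*\}_{i=0}^d)$ such that: (1) $A,A^*$ are multiplicity-free elements of $\mathrm{End}(V)$; (2) $\{E_i\}_{i=0}^d$ is an ordering of the primitive idempotents of $A$; (3) $\{E_i^*\}_{i=0}^d$ is an ordering of the primitive idempotents of $A^*$; (4) $E_iA^*E_j$ is $0$ if $|i-j|>1$ and is nonzero if $|i-j|=1$; (5) $E_i^*AE_j^*$ is $0$ if $|i-j|>1$ and is nonzero if $|i-j|=1$. If $\Phi$ is a Leonard system then so is $\Phi^{\Downarrow}=(A;\{E_{d-i}\}_{i=0}^d;A^*;\{E_i^*\}_{i=0}^d)$. The $\Phi$-split decomposition of $V$ is the sequence of subspaces $U_i=(E_0^*V+\cdots+E_i^*V)\cap(E_0V+E_1V+\cdots+E_{d-i}V)$, $0\le i\le d$. The $\Phi^{\Downarrow}$-split decomposition is defined in the same way with respect to $\Phi^{\Downarrow}$, that is, $U_i^{\Downarrow}=(E_0^*V+\cdots+E_i^*V)\cap(E_dV+E_{d-1}V+\cdots+E_{i}V)$, $0\le i\le d$. For $0\le k\le d$, $\tau_k(\xi)=\prod_{i=1}^{k}(\xi-\theta_{i-1})$ and $\eta_k(\xi)=\prod_{i=1}^{k}(\xi-\theta_{d-i+1})$,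 with $\tau_0=\eta_0=1$. $\Delta_d=\{(r,s,t)\mid r,s,t\in\mathbb{N},\ r+s+t=d\}$; its elements are called locations. *)

theory Defs
  imports Complex_Main "HOL-Computational_Algebra.Polynomial" "HOL-Library.Set_Algebras"
begin

(* Throughout, the vector space V is the whole type 'v, and s is its scalar multiplication. *)

definition eigenspace :: "('f::field \<Rightarrow> 'v::ab_group_add \<Rightarrow> 'v) \<Rightarrow> ('v \<Rightarrow> 'v) \<Rightarrow> 'f \<Rightarrow> 'v set"
  where "eigenspace s f \<theta> = {x. f x = s \<theta> x}"

definition eigenvalue :: "('f::field \<Rightarrow> 'v::ab_group_add \<Rightarrow> 'v) \<Rightarrow> ('v \<Rightarrow> 'v) \<Rightarrow> 'f \<Rightarrow> bool"
  where "eigenvalue s f \<theta> \<longleftrightarrow> (\<exists>x\<in>eigenspace s f \<theta>. x \<noteq> 0)"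

definition diagonalizable :: "('f::field \<Rightarrow> 'v::ab_group_add \<Rightarrow> 'v) \<Rightarrow> ('v \<Rightarrow> 'v) \<Rightarrow> bool"
  where "diagonalizable s f \<longleftrightarrow>
    (\<exists>B. \<not> module.dependent s B \<and> module.span s B = UNIV \<and>
      (\<forall>b\<in>B. \<exists>\<theta>. b \<in> eigenspace s f \<theta>))"

definition multiplicity_free :: "('f::field \<Rightarrow> 'v::ab_group_add \<Rightarrow> 'v) \<Rightarrow> ('v \<Rightarrow> 'v) \<Rightarrow> bool"
  where "multiplicity_free s f \<longleftrightarrow>
    Vector_Spaces.linear s s f \<and> diagonalizable s f \<and>
    (\<forall>\<theta>. eigenvalue s f \<theta> \<longrightarrow> vector_space.dim s (eigenspace s f \<theta>) = 1)"

definition primitive_idempotent ::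
    "('f::field \<Rightarrow> 'v::ab_group_add \<Rightarrow> 'v) \<Rightarrow> ('v \<Rightarrow> 'v) \<Rightarrow> 'f \<Rightarrow> ('v \<Rightarrow> 'v) \<Rightarrow> bool"
  where "primitive_idempotent s f \<theta> e \<longleftrightarrow>
    eigenvalue s f \<theta> \<and> Vector_Spaces.linear s s e \<and>
    (\<forall>x\<in>eigenspace s f \<theta>. e x = x) \<and>
    (\<forall>\<mu>. \<mu> \<noteq> \<theta> \<longrightarrow> (\<forall>x\<in>eigenspace s f \<mu>. e x = 0))"

definition primitive_idempotents ::
    "('f::field \<Rightarrow> 'v::ab_group_add \<Rightarrow> 'v) \<Rightarrow> ('v \<Rightarrow> 'v) \<Rightarrow> ('v \<Rightarrow> 'v) set"
  where "primitive_idempotents s f = {e. \<exists>\<theta>. primitive_idempotent s f \<theta> e}"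

(* The endomorphism p(f), for a polynomial p and an endomorphism f. *)
definition poly_end ::
    "('f::field \<Rightarrow> 'v::ab_group_add \<Rightarrow> 'v) \<Rightarrow> 'f poly \<Rightarrow> ('v \<Rightarrow> 'v) \<Rightarrow> 'v \<Rightarrow> 'v"
  where "poly_end s p f x = (\<Sum>i\<le>degree p. s (coeff p i) ((f ^^ i) x))"

(* As is the starred map A^*, and Es the sequence of the E_i^*. The sequences are functions
   on nat of which only the values at indices 0, ..., d are relevant. *)
locale leonard_system = vector_space s
  for s :: "'f::field \<Rightarrow> 'v::ab_group_add \<Rightarrow> 'v" +
  fixes d :: nat
    and A :: "'v \<Rightarrow> 'v" and E :: "nat \<Rightarrow> 'v \<Rightarrow> 'v"
    and As :: "'v \<Rightarrow> 'v" and Es :: "nat \<Rightarrow> 'v \<Rightarrow> 'v"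
  assumes dimension: "vector_space.dim s (UNIV :: 'v set) = d + 1"
    and multiplicity_free_A: "multiplicity_free s A"
    and multiplicity_free_As: "multiplicity_free s As"
    and ordering_E: "bij_betw E {0..d} (primitive_idempotents s A)"
    and ordering_Es: "bij_betw Es {0..d} (primitive_idempotents s As)"
    and E_As_E_zero: "\<And>i j. i \<le> d \<Longrightarrow> j \<le> d \<Longrightarrow> \<bar>int i - int j\<bar> > 1 \<Longrightarrow>
      E i \<circ> As \<circ> E j = (\<lambda>_. 0)"
    and E_As_E_nonzero: "\<And>i j. i \<le> d \<Longrightarrow> j \<le> d \<Longrightarrow> \<bar>int i - int j\<bar> = 1 \<Longrightarrow>
      E i \<circ> As \<circ> E j \<noteq> (\<lambda>_. 0)"
    and Es_A_Es_zero: "\<And>i j. i \<le> d \<Longrightarrow> j \<le> d \<Longrightarrow> \<bar>int i - int j\<bar> > 1 \<Longrightarrow>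
      Es i \<circ> A \<circ> Es j = (\<lambda>_. 0)"
    and Es_A_Es_nonzero: "\<And>i j. i \<le> d \<Longrightarrow> j \<le> d \<Longrightarrow> \<bar>int i - int j\<bar> = 1 \<Longrightarrow>
      Es i \<circ> A \<circ> Es j \<noteq> (\<lambda>_. 0)"

(* The sums of subspaces are the pointwise (Minkowski) sums of Set_Algebras. *)
definition split_decomposition ::
    "nat \<Rightarrow> (nat \<Rightarrow> 'v \<Rightarrow> 'v) \<Rightarrow> (nat \<Rightarrow> 'v \<Rightarrow> 'v) \<Rightarrow> nat \<Rightarrow> 'v::ab_group_add set"
  where "split_decomposition d E Es i =
    (\<Sum>j = 0..i. range (Es j)) \<inter> (\<Sum>j = 0..d - i. range (E j))"

(* The idempotent sequence of the system obtained by reversing E_0, ..., E_d. *)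
definition reversed :: "nat \<Rightarrow> (nat \<Rightarrow> 'c) \<Rightarrow> nat \<Rightarrow> 'c"
  where "reversed d E i = E (d - i)"

definition split_decomposition_down ::
    "nat \<Rightarrow> (nat \<Rightarrow> 'v \<Rightarrow> 'v) \<Rightarrow> (nat \<Rightarrow> 'v \<Rightarrow> 'v) \<Rightarrow> nat \<Rightarrow> 'v::ab_group_add set"
  where "split_decomposition_down d E Es = split_decomposition d (reversed d E) Es"

definition tau :: "(nat \<Rightarrow> 'f::field) \<Rightarrow> nat \<Rightarrow> 'f poly"
  where "tau \<theta> k = (\<Prod>i = 1..k. [:- \<theta> (i - 1), 1:])"

definition eta :: "nat \<Rightarrow> (nat \<Rightarrow> 'f::field) \<Rightarrow> nat \<Rightarrow> 'f poly"
  where "eta d \<theta> k = (\<Prod>i = 1..k. [:- \<theta> (d - i + 1), 1:])"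

definition locations :: "nat \<Rightarrow> (nat \<times> nat \<times> nat) set"
  where "locations d = {(r, s, t). r + s + t = d}"

end

(* Write tau_i for tau \<theta> i. As the primitive idempotents of each of A and A^* sum to the
   identity, a vector lies in a partial sum of their ranges as soon as the remaining idempotents
   kill it. For L (0, d - i, i) = tau_i(A) v: the map E_j kills it for j < i since
   E_j tau_i(A) = tau_i(\<theta>_j) E_j, and E_j^* kills it for j > i since tau_i has degree i and A
   moves E_0^* V + ... + E_k^* V into E_0^* V + ... + E_(k+1)^* V. *)

theory Submission
  imports Defs
begin

section \<open>Evaluation on eigenvectors, partial sums of ranges, and the polynomials
  \<open>tau\<close>\<close>

lemma primitive_idempotent_eigenspace:
  assumes "primitive_idempotent s f \<theta> e" and "x \<in> eigenspace s f \<mu>"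
  shows "e x = (if \<mu> = \<theta> then x else 0)"
  using assms by (auto simp: primitive_idempotent_def)

text \<open>Stated for arbitrary maps \<open>E j\<close>, so that it serves both \<open>Es\<close>
  and \<open>reversed d E\<close>.\<close>

lemma mem_sum_ranges:
  fixes E :: "nat \<Rightarrow> 'v \<Rightarrow> 'v::ab_group_add"
  assumes "(\<Sum>j=0..d. E j x) = x" and "k \<le> d"
    and "\<And>j. k < j \<Longrightarrow> j \<le> d \<Longrightarrow> E j x = 0"
  shows "x \<in> (\<Sum>j=0..k. range (E j))"
proof -
  have "(\<Sum>j=0..k. E j x) = (\<Sum>j=0..d. E j x)"
    using assms by (intro sum.mono_neutral_left) auto
  then have "x = (\<Sum>j=0..k. E j x)" using assms(1) by simp
  then show ?thesis by (auto simp: set_sum_alt)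
qed

lemma degree_tau_le: "degree (tau \<theta> k) \<le> k"
  unfolding tau_def by (rule order.trans[OF degree_prod_sum_le]) auto

lemma poly_tau_eq_0: "j < k \<Longrightarrow> poly (tau \<theta> k) (\<theta> j) = 0"
  \<comment> \<open>The product starts at index 1, so the factor with root \<open>\<theta> j\<close>
    has index \<open>Suc j\<close>.\<close>
  unfolding tau_def by (auto simp: poly_prod intro!: prod_zero bexI[of _ "Suc j"])

section \<open>Primitive idempotents of a multiplicity-free map\<close>

context vector_space
begin

lemma linear_eq_on_eigenbasis:
  assumes B: "span B = UNIV" "\<forall>b\<in>B. \<exists>\<theta>. b \<in> eigenspace scale f \<theta>"
    and g: "Vector_Spaces.linear scale scale g" and h: "Vector_Spaces.linear scale scale h"
    and eq: "\<And>\<mu> x. x \<in> eigenspace scale f \<mu> \<Longrightarrow> g x = h x"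
  shows "g = h"
proof
  fix x
  interpret vector_space_pair scale scale ..
  show "g x = h x"
    by (rule linear_eq_on[OF g h, of x B]) (use B eq in auto)
qed

text \<open>Diagonalizability provides a spanning set of eigenvectors. Uniqueness, orthogonality and
  the relation between \<open>e\<close> and \<open>f\<close> are all checked on eigenvectors by
  means of this.\<close>

lemma linear_eq_on_eigenvectors:
  assumes "multiplicity_free scale f"
    and "Vector_Spaces.linear scale scale g" and "Vector_Spaces.linear scale scale h"
    and "\<And>\<mu> x. x \<in> eigenspace scale f \<mu> \<Longrightarrow> g x = h x"
  shows "g = h"
proof -
  obtain B where "span B = UNIV" "\<forall>b\<in>B. \<exists>\<theta>. b \<in> eigenspace scale f \<theta>"
    using assms(1) unfolding multiplicity_free_def diagonalizable_def by auto
  then show ?thesis using assms by (intro linear_eq_on_eigenbasis)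
qed

text \<open>A one-dimensional eigenspace has a basis \<open>{c}\<close>, and the nonzero vector
  \<open>b\<close> is an invertible multiple of \<open>c\<close>.\<close>

lemma eigenspace_subset_span:
  assumes "multiplicity_free scale f" and "b \<in> eigenspace scale f \<mu>" and "b \<noteq> 0"
  shows "eigenspace scale f \<mu> \<subseteq> span {b}"
proof -
  have "dim (eigenspace scale f \<mu>) = 1"
    using assms unfolding multiplicity_free_def eigenvalue_def by auto
  then obtain C where C: "C \<subseteq> eigenspace scale f \<mu>" "independent C"
    "eigenspace scale f \<mu> \<subseteq> span C" "card C = 1"
    using basis_exists[of "eigenspace scale f \<mu>"] by metis
  then obtain c where c: "C = {c}" by (auto simp: card_1_singleton_iff)
  with C assms(2) obtain k where k: "b = scale k c" by (auto simp: span_singleton)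
  with assms(3) have "k \<noteq> 0" by auto
  with k have "c = scale (inverse k) b" by simp
  then have "c \<in> span {b}" by (auto simp: span_singleton)
  then have "span C \<subseteq> span {b}" using c by (intro span_minimal) auto
  with C show ?thesis by auto
qed

text \<open>A bijection onto \<open>primitive_idempotents\<close> does not by itself say that every
  eigenvalue has an idempotent. This lemma supplies it, so that the idempotents can be shown to sum
  to the identity.\<close>

lemma primitive_idempotent_exists:
  assumes f: "multiplicity_free scale f"
    and B: "independent B" "span B = UNIV" "\<forall>b\<in>B. \<exists>\<theta>. b \<in> eigenspace scale f \<theta>"
    and b: "b \<in> B" "b \<in> eigenspace scale f \<mu>"
  obtains e where "primitive_idempotent scale f \<mu> e"
proof -
  interpret vector_space_pair scale scale ..
  have lf: "Vector_Spaces.linear scale scale f" using f by (simp add: multiplicity_free_def)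
  have b0: "b \<noteq> 0" using B(1) b(1) dependent_zero by blast
  \<comment> \<open>The projection onto the span of the \<open>\<mu>\<close>-eigenvectors in
    \<open>B\<close> along the other basis vectors.\<close>
  define e where "e = construct B (\<lambda>c. if c \<in> eigenspace scale f \<mu> then c else 0)"
  have le: "Vector_Spaces.linear scale scale e"
    unfolding e_def using B(1) by (rule linear_construct)
  have eB: "e c = (if c \<in> eigenspace scale f \<mu> then c else 0)" if "c \<in> B" for c
    unfolding e_def using B(1) that by (rule construct_basis)
  have lfe: "Vector_Spaces.linear scale scale (\<lambda>x. f (e x))"
    and lef: "Vector_Spaces.linear scale scale (\<lambda>x. e (f x))"
    using Vector_Spaces.linear_compose[OF le lf] Vector_Spaces.linear_compose[OF lf le]
    by (simp_all add: o_def)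
  have fe: "f (e x) = scale \<mu> (e x)" for x
    by (rule linear_eq_on[OF lfe linear_compose_scale_right[OF le], of x B])
      (use B(2) eB linear_0[OF lf] in \<open>auto simp: eigenspace_def\<close>)
  have ef: "e (f x) = f (e x)" for x
  proof (rule linear_eq_on[OF lef lfe, of x B])
    fix c assume "c \<in> B"
    moreover obtain \<nu> where "c \<in> eigenspace scale f \<nu>" using B(3) \<open>c \<in> B\<close> by auto
    ultimately show "e (f c) = f (e c)"
      using eB[of c] linear_0[OF lf] linear_scale[OF le] by (auto simp: eigenspace_def)
  qed (use B(2) in auto)
  \<comment> \<open>Such an \<open>x\<close> need not lie in \<open>B\<close>. As \<open>e\<close>
    commutes with \<open>f\<close> and maps into the \<open>\<mu>\<close>-eigenspace,
    \<open>e x\<close> is scaled equally by \<open>\<nu>\<close> and \<open>\<mu>\<close>.\<close>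
  have "e x = 0" if "x \<in> eigenspace scale f \<nu>" "\<nu> \<noteq> \<mu>" for x \<nu>
  proof -
    have "scale \<nu> (e x) = scale \<mu> (e x)"
      using ef[of x] fe[of x] that(1) linear_scale[OF le] by (simp add: eigenspace_def)
    then show ?thesis using that(2) by simp
  qed
  \<comment> \<open>Multiplicity-freeness enters here: \<open>x\<close> is a multiple of
    \<open>b\<close>, which \<open>e\<close> fixes.\<close>
  moreover have "e x = x" if "x \<in> eigenspace scale f \<mu>" for x
  proof -
    have "x \<in> span {b}" using eigenspace_subset_span[OF f b(2) b0] that by auto
    then show ?thesis
      using eB[OF b(1)] b(2) linear_scale[OF le] by (auto simp: span_singleton)
  qed
  ultimately have "primitive_idempotent scale f \<mu> e"
    using b b0 le by (auto simp: primitive_idempotent_def eigenvalue_def)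
  then show ?thesis by (rule that)
qed

lemma primitive_idempotent_unique:
  assumes "multiplicity_free scale f"
    and "primitive_idempotent scale f \<theta> e" and "primitive_idempotent scale f \<theta> e'"
  shows "e = e'"
  using assms(2,3)
  by (intro linear_eq_on_eigenvectors[OF assms(1)])
    (simp_all add: primitive_idempotent_eigenspace[OF assms(2)]
      primitive_idempotent_eigenspace[OF assms(3)] primitive_idempotent_def)

text \<open>On an eigenvector from the basis exactly one summand survives, the idempotent of its
  eigenvalue.\<close>

lemma sum_primitive_idempotents:
  fixes E :: "nat \<Rightarrow> 'b \<Rightarrow> 'b"
  assumes f: "multiplicity_free scale f"
    and E: "bij_betw E {0..d} (primitive_idempotents scale f)"
  shows "(\<Sum>j=0..d. E j x) = x"
proof -
  interpret vector_space_pair scale scale ..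
  obtain B where B: "independent B" "span B = UNIV" "\<forall>b\<in>B. \<exists>\<theta>. b \<in> eigenspace scale f \<theta>"
    using f unfolding multiplicity_free_def diagonalizable_def by auto
  have E_prim: "\<exists>\<theta>. primitive_idempotent scale f \<theta> (E j)" if "j \<in> {0..d}" for j
    using bij_betwE[OF E] that by (auto simp: primitive_idempotents_def)
  then have lE: "Vector_Spaces.linear scale scale (E j)" if "j \<in> {0..d}" for j
    using that by (auto simp: primitive_idempotent_def)
  show ?thesis
  proof (rule linear_eq_on[of "\<lambda>x. \<Sum>j=0..d. E j x" "\<lambda>x. x" x B])
    show "Vector_Spaces.linear scale scale (\<lambda>x. \<Sum>j=0..d. E j x)"
      using lE by (intro linear_compose_sum) auto
    fix b assume b: "b \<in> B"
    then obtain \<mu> where \<mu>: "b \<in> eigenspace scale f \<mu>" using B(3) by auto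
    obtain e where e: "primitive_idempotent scale f \<mu> e"
      using primitive_idempotent_exists[OF f B b \<mu>] .
    then have "e \<in> E ` {0..d}"
      using E by (auto simp: bij_betw_def primitive_idempotents_def)
    then obtain j where j: "j \<in> {0..d}" "E j = e" by auto
    have "E k b = (if k = j then b else 0)" if k: "k \<in> {0..d}" for k
    proof (cases "k = j")
      case True
      then show ?thesis using primitive_idempotent_eigenspace[OF e \<mu>] j by simp
    next
      case False
      obtain \<nu> where \<nu>: "primitive_idempotent scale f \<nu> (E k)" using E_prim[OF k] by auto
      \<comment> \<open>Idempotents of the same eigenvalue coincide, so injectivity of
        \<open>E\<close> separates the eigenvalues.\<close>
      have "E k \<noteq> E j" using False E k j(1) by (auto simp: bij_betw_def inj_on_def)
      then have "\<mu> \<noteq> \<nu>" using primitive_idempotent_unique[OF f e] \<nu> j(2) by auto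
      then show ?thesis using primitive_idempotent_eigenspace[OF \<nu> \<mu>] False by simp
    qed
    then have "(\<Sum>k=0..d. E k b) = (\<Sum>k=0..d. if k = j then b else 0)"
      by (intro sum.cong) auto
    then show "(\<Sum>k=0..d. E k b) = b" using j(1) by simp
  qed (use B(2) linear_id in \<open>auto simp: id_def\<close>)
qed

text \<open>\<open>E j\<close> and \<open>E k\<close> belong to different eigenvalues, so every
  eigenvector is killed by at least one of them.\<close>

lemma primitive_idempotents_orthogonal:
  fixes E :: "nat \<Rightarrow> 'b \<Rightarrow> 'b"
  assumes f: "multiplicity_free scale f"
    and E: "bij_betw E {0..d} (primitive_idempotents scale f)"
    and jk: "j \<le> d" "k \<le> d" "j \<noteq> k"
  shows "E j (E k x) = 0"
proof -
  interpret vector_space_pair scale scale ..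
  obtain \<mu> \<nu> where \<mu>: "primitive_idempotent scale f \<mu> (E j)"
    and \<nu>: "primitive_idempotent scale f \<nu> (E k)"
    using bij_betw_apply[OF E, of j] bij_betw_apply[OF E, of k] jk
    by (auto simp: primitive_idempotents_def)
  have "E j \<noteq> E k" using E jk by (auto simp: bij_betw_def inj_on_def)
  then have ne: "\<mu> \<noteq> \<nu>" using primitive_idempotent_unique[OF f \<mu>] \<nu> by auto
  have lj: "Vector_Spaces.linear scale scale (E j)" and lk: "Vector_Spaces.linear scale scale (E k)"
    using \<mu> \<nu> by (auto simp: primitive_idempotent_def)
  have "(\<lambda>x. E j (E k x)) = (\<lambda>_. 0)"
    by (rule linear_eq_on_eigenvectors[OF f])
      (use ne Vector_Spaces.linear_compose[OF lk lj] linear_zero linear_0[OF lj] in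
        \<open>auto simp: o_def primitive_idempotent_eigenspace[OF \<mu>]
          primitive_idempotent_eigenspace[OF \<nu>]\<close>)
  then show ?thesis by metis
qed

text \<open>On an eigenvector \<open>y\<close> both sides are \<open>scale \<theta> y\<close> if its
  eigenvalue is \<open>\<theta>\<close>, and 0 if \<open>e\<close> kills it.\<close>

lemma primitive_idempotent_apply:
  assumes f: "multiplicity_free scale f" and e: "primitive_idempotent scale f \<theta> e"
  shows "e (f x) = scale \<theta> (e x)"
proof -
  interpret vector_space_pair scale scale ..
  have lf: "Vector_Spaces.linear scale scale f" and le: "Vector_Spaces.linear scale scale e"
    using f e by (auto simp: primitive_idempotent_def multiplicity_free_def)
  have "e (f y) = scale \<theta> (e y)" if "y \<in> eigenspace scale f \<mu>" for y \<mu>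
    using primitive_idempotent_eigenspace[OF e that] linear_scale[OF le] that
    by (auto simp: eigenspace_def)
  then have "(\<lambda>x. e (f x)) = (\<lambda>x. scale \<theta> (e x))"
    by (intro linear_eq_on_eigenvectors[OF f] linear_compose_scale_right le)
      (use Vector_Spaces.linear_compose[OF lf le] in \<open>auto simp: o_def\<close>)
  then show ?thesis by metis
qed

lemma primitive_idempotent_poly_end:
  assumes f: "multiplicity_free scale f" and e: "primitive_idempotent scale f \<theta> e"
  shows "e (poly_end scale p f x) = scale (poly p \<theta>) (e x)"
proof -
  interpret vector_space_pair scale scale ..
  have le: "Vector_Spaces.linear scale scale e" using e by (simp add: primitive_idempotent_def)
  have "e ((f ^^ i) x) = scale (\<theta> ^ i) (e x)" for i
    by (induction i) (simp_all add: primitive_idempotent_apply[OF f e])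
  then show ?thesis
    by (simp add: poly_end_def poly_altdef linear_sum[OF le] linear_scale[OF le]
        scale_sum_left)
qed

end

section \<open>The tridiagonal action of \<open>A\<close> and membership in the split
  decomposition\<close>

context leonard_system
begin

lemma linear_A: "Vector_Spaces.linear s s A"
  using multiplicity_free_A by (simp add: multiplicity_free_def)

lemma linear_Es: "j \<le> d \<Longrightarrow> Vector_Spaces.linear s s (Es j)"
  using bij_betwE[OF ordering_Es]
  by (fastforce simp: primitive_idempotents_def primitive_idempotent_def)

text \<open>Induction on \<open>k\<close>, with the identity written as the sum of the
  \<open>Es l\<close> in front of \<open>w\<close>, the vector to which the last \<open>A\<close> is
  applied. The base case is orthogonality.\<close>

lemma Es_funpow_A_eq_0:
  assumes "v \<in> range (Es 0)" and "k < j" and "j \<le> d"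
  shows "Es j ((A ^^ k) v) = 0"
  using assms(2,3)
proof (induction k arbitrary: j)
  case 0
  then show ?case
    using assms(1) primitive_idempotents_orthogonal[OF multiplicity_free_As ordering_Es] by auto
next
  case (Suc k)
  interpret vector_space_pair s s ..
  define w where "w = (A ^^ k) v"
  have "Es j (A (Es l w)) = 0" if "l \<in> {0..d}" for l
  proof (cases "k < l")
    case True
    then have "Es l w = 0" using Suc.IH that by (simp add: w_def)
    then show ?thesis using Suc.prems linear_A linear_Es by (simp add: linear_0)
  next
    case False
    \<comment> \<open>Here \<open>l \<le> k\<close> and \<open>Suc k < j\<close>, so the indices
      differ by at least 2.\<close>
    then have "Es j \<circ> A \<circ> Es l = (\<lambda>_. 0)" using Suc.prems that by (intro Es_A_Es_zero) auto
    then show ?thesis by (simp add: fun_eq_iff)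
  qed
  then have "(\<Sum>l=0..d. Es j (A (Es l w))) = 0" by simp
  moreover have "(\<Sum>l=0..d. Es j (A (Es l w))) = Es j (A (\<Sum>l=0..d. Es l w))"
    using Suc.prems linear_A linear_Es by (simp add: linear_sum)
  ultimately show ?case
    using sum_primitive_idempotents[OF multiplicity_free_As ordering_Es] by (simp add: w_def)
qed

lemma Es_poly_end_A_eq_0:
  assumes "v \<in> range (Es 0)" and "degree p < j" and "j \<le> d"
  shows "Es j (poly_end s p A v) = 0"
proof -
  interpret vector_space_pair s s ..
  show ?thesis using Es_funpow_A_eq_0[OF assms(1)] assms(2,3) linear_Es[of j]
    by (simp add: poly_end_def linear_sum linear_scale)
qed

lemma poly_end_tau_in_split_decomposition_down:
  assumes \<theta>: "\<And>i. i \<le> d \<Longrightarrow> primitive_idempotent s A (\<theta> i) (E i)"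
    and v: "v \<in> range (Es 0)" and "i \<le> d"
  shows "poly_end s (tau \<theta> i) A v \<in> split_decomposition_down d E Es i"
    (is "?w \<in> _")
proof -
  have "?w \<in> (\<Sum>j=0..i. range (Es j))"
    using sum_primitive_idempotents[OF multiplicity_free_As ordering_Es] \<open>i \<le> d\<close>
      Es_poly_end_A_eq_0[OF v] degree_tau_le[of \<theta> i]
    by (intro mem_sum_ranges[where d = d]) auto
  moreover have "?w \<in> (\<Sum>j=0..d-i. range (reversed d E j))"
  proof (rule mem_sum_ranges)
    show "(\<Sum>j=0..d. reversed d E j ?w) = ?w"
      using sum_primitive_idempotents[OF multiplicity_free_A ordering_E, of ?w]
        sum.atLeastAtMost_rev[of "\<lambda>j. E j ?w" 0 d]
      by (simp add: reversed_def)
    fix j assume "d - i < j" "j \<le> d"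
    \<comment> \<open>The bounds on \<open>j\<close> give \<open>d - j < i\<close>, so
      \<open>\<theta> (d - j)\<close> is a root of \<open>tau \<theta> i\<close>.\<close>
    then show "reversed d E j ?w = 0"
      using primitive_idempotent_poly_end[OF multiplicity_free_A \<theta>, of "d - j"]
        poly_tau_eq_0[of "d - j" i \<theta>]
      by (simp add: reversed_def)
  qed simp
  ultimately show ?thesis
    by (simp add: split_decomposition_down_def split_decomposition_def)
qed

end

theorem lemma6p5:
  fixes scale :: "'f::field \<Rightarrow> 'v::ab_group_add \<Rightarrow> 'v"
    and d :: nat
    and A As :: "'v \<Rightarrow> 'v"
    and E Es :: "nat \<Rightarrow> 'v \<Rightarrow> 'v"
    and \<theta> :: "nat \<Rightarrow> 'f"
    and v :: 'v
    and L :: "nat \<times> nat \<times> nat \<Rightarrow> 'v"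
  assumes "leonard_system scale d A E As Es"
    and "\<And>i. i \<le> d \<Longrightarrow> primitive_idempotent scale A (\<theta> i) (E i)"
    and "v \<in> range (Es 0)" and "v \<noteq> 0"
    and "\<And>r s t. (r, s, t) \<in> locations d \<Longrightarrow>
      L (r, s, t) = poly_end scale (eta d \<theta> r) A
        (poly_end scale (tau \<theta> t) A v)"
  shows "\<forall>i\<le>d. L (0, d - i, i) \<in> split_decomposition_down d E Es i"
proof (intro allI impI)
  fix i assume "i \<le> d"
  interpret leonard_system scale d A E As Es by fact
  \<comment> \<open>\<open>eta d \<theta> 0\<close> is the empty product 1, and
    \<open>poly_end\<close> sends 1 to the identity map.\<close>
  have "L (0, d - i, i) = poly_end scale (tau \<theta> i) A v"
    using assms(5)[of 0 "d - i" i] \<open>i \<le> d\<close>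
    by (simp add: locations_def eta_def poly_end_def[of _ 1])
  then show "L (0, d - i, i) \<in> split_decomposition_down d E Es i"
    using poly_end_tau_in_split_decomposition_down[OF assms(2,3)] \<open>i \<le> d\<close> by simp
qed

end
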